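(* Let $C[0,1]$ be the space of continuous functions $f\colon[0,1]\to\mathbb{R}$ with the supremum norm, regarded as an abelian Polish group under addition. The set of somewhere differentiable functions $$\mathcal{SD}=\{f\in C[0,1]:\ f \text{ is differentiable at some point } x\in[0,1]\}$$ is not Haar-countable in $C[0,1]$.
   Context: Differentiable at a point means having a finite derivative there (one-sided at the endpoints $0$ and $1$). A subset $A$ of an abelian Polish group $X$ is called Haar-countable if there are a Borel set $B\subseteq X$ with $A\subseteq B$ and a set $C\subseteq X$ homeomorphic to the Cantor space $\{0,1\}^{\mathbb{N}}$ such that $(C+x)\cap B$ is countable (possibly finite or empty) for all $x\in X$. *)

theory Defs
  imports "HOL-Analysis.Analysis"
begin

section \<open>Haar-countable subsets of an abelian Polish group\<close>

text \<open>
  An abelian Polish group is a type of sort \<open>{topological_ab_group_add, polish_space}\<close>. The class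
  \<^class>\<open>polish_space\<close> carries a complete metric, but the definition below only uses the group
  structure and the topology. The Cantor space is \<^typ>\<open>nat \<Rightarrow> bool\<close>, with the product of the
  discrete topologies.
\<close>

definition haar_countable :: "'a::{topological_ab_group_add, polish_space} set \<Rightarrow> bool"
  where "haar_countable A \<longleftrightarrow>
    (\<exists>B\<in>sets borel. A \<subseteq> B \<and>
      (\<exists>C. C homeomorphic (UNIV :: (nat \<Rightarrow> bool) set) \<and>
        (\<forall>x. countable ((\<lambda>c. c + x) ` C \<inter> B))))"


section \<open>Continuous functions on a compact metric space form a Polish space\<close>

class compact_metric_space = metric_space +
  assumes compact_UNIV_metric: "compact (UNIV :: 'a set)"

lemma bcontfun_separable:
  "\<exists>D :: ('a::compact_metric_space \<Rightarrow>\<^sub>C 'b::polish_space) set.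
     countable D \<and> (\<forall>f. \<forall>e>0. \<exists>d\<in>D. dist f d < e)"
proof -
  obtain Y :: "'b set" where Y: "countable Y" "\<And>U. open U \<Longrightarrow> U \<noteq> {} \<Longrightarrow> \<exists>y\<in>Y. y \<in> U"
    using countable_dense_exists by blast
  have "\<exists>xs :: 'a list. \<forall>x. \<exists>i<length xs. dist x (xs ! i) < inverse (real (Suc n))" for n
  proof -
    have "(UNIV :: 'a set) \<subseteq> (\<Union>x\<in>UNIV. ball x (inverse (real (Suc n))))"
      by (rule subsetI, rule UN_I[OF UNIV_I], rule centre_in_ball[THEN iffD2]) simp
    then obtain K :: "'a set" where K: "finite K" "UNIV \<subseteq> (\<Union>x\<in>K. ball x (inverse (real (Suc n))))"
      by (rule compactE_image[OF compact_UNIV_metric, rotated]) auto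
    obtain xs where xs: "set xs = K" using finite_list[OF K(1)] by blast
    show ?thesis
    proof (intro exI[of _ xs] allI)
      fix x
      obtain k where "k \<in> K" "x \<in> ball k (inverse (real (Suc n)))" using K(2) by blast
      then show "\<exists>i<length xs. dist x (xs ! i) < inverse (real (Suc n))"
        unfolding xs[symmetric] in_set_conv_nth by (auto simp: dist_commute)
    qed
  qed
  then obtain net :: "nat \<Rightarrow> 'a list"
    where net: "\<And>n x. \<exists>i<length (net n). dist x (net n ! i) < inverse (real (Suc n))"
    by metis
  define P where "P = (\<lambda>(n, k, ys) (h :: 'a \<Rightarrow>\<^sub>C 'b).
    (\<forall>x y. dist x y < inverse (real (Suc n)) \<longrightarrow> dist (h x) (h y) < inverse (real (Suc k))) \<and>
    (\<forall>i<length (net n). dist (h (net n ! i)) (ys ! i) < inverse (real (Suc k))))"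
  define D where "D = (\<lambda>t. SOME h. P t h) ` (UNIV \<times> UNIV \<times> lists Y)"
  have "countable D"
    unfolding D_def using Y(1) by (intro countable_image countable_SIGMA countable_lists) auto
  moreover have "\<exists>d\<in>D. dist f d < e" if e: "e > 0" for f :: "'a \<Rightarrow>\<^sub>C 'b" and e
  proof -
    obtain k where k: "inverse (real (Suc k)) < e / 5"
      using reals_Archimedean[of "e / 5"] e by auto
    define r where "r = inverse (real (Suc k))"
    have r: "r > 0" "5 * r < e" using k by (auto simp: r_def)
    have "uniformly_continuous_on UNIV f"
      by (intro compact_uniformly_continuous compact_UNIV_metric) auto
    then obtain s where s: "s > 0" "\<And>x y. dist x y < s \<Longrightarrow> dist (f x) (f y) < r"
      unfolding uniformly_continuous_on_def using r(1) by (metis UNIV_I)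
    obtain n where n: "inverse (real (Suc n)) < s" using reals_Archimedean[OF s(1)] by auto
    have "\<exists>y\<in>Y. dist v y < r" for v
      using Y(2)[of "ball v r"] r(1) by auto
    then obtain g where g: "\<And>v. g v \<in> Y" "\<And>v. dist v (g v) < r" by metis
    define ys where "ys = map (\<lambda>x. g (f x)) (net n)"
    have Pf: "P (n, k, ys) f"
      using s(2) n g(2) by (auto simp: P_def ys_def r_def simp del: of_nat_Suc)
    define h where "h = (SOME h. P (n, k, ys) h)"
    have Ph: "P (n, k, ys) h" unfolding h_def using Pf by (rule someI)
    have "ys \<in> lists Y" using g(1) by (auto simp: ys_def)
    then have "h \<in> D" unfolding D_def h_def by (intro image_eqI[of _ _ "(n, k, ys)"]) auto
    moreover have "dist (f x) (h x) \<le> 4 * r" for x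
    proof -
      obtain i where i: "i < length (net n)" "dist x (net n ! i) < inverse (real (Suc n))"
        using net by blast
      have "dist (f x) (f (net n ! i)) < r" "dist (f (net n ! i)) (ys ! i) < r"
        using Pf i by (auto simp: P_def r_def)
      moreover have "dist (h x) (h (net n ! i)) < r" "dist (h (net n ! i)) (ys ! i) < r"
        using Ph i by (auto simp: P_def r_def)
      moreover have "dist (f x) (h x) \<le> dist (f x) (ys ! i) + dist (h x) (ys ! i)"
        by (rule dist_triangle2)
      moreover have "dist (f x) (ys ! i) \<le> dist (f x) (f (net n ! i)) + dist (f (net n ! i)) (ys ! i)"
        by (rule dist_triangle)
      moreover have "dist (h x) (ys ! i) \<le> dist (h x) (h (net n ! i)) + dist (h (net n ! i)) (ys ! i)"
        by (rule dist_triangle)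
      ultimately show ?thesis by linarith
    qed
    then have "dist f h \<le> 4 * r" by (rule dist_bound)
    then have "dist f h < e" using r by linarith
    ultimately show ?thesis by blast
  qed
  ultimately show ?thesis by blast
qed

instance bcontfun :: (compact_metric_space, polish_space) second_countable_topology
proof
  obtain D :: "('a \<Rightarrow>\<^sub>C 'b) set" where D: "countable D" "\<And>f e. e > 0 \<Longrightarrow> \<exists>d\<in>D. dist f d < e"
    using bcontfun_separable by blast
  define \<B> where "\<B> = (\<lambda>(d, n). ball d (inverse (real (Suc n)))) ` (D \<times> UNIV)"
  have "topological_basis \<B>"
  proof (rule topological_basisI)
    fix U and f :: "'a \<Rightarrow>\<^sub>C 'b"
    assume "open U" "f \<in> U"
    then obtain e where e: "e > 0" "ball f e \<subseteq> U" by (auto simp: open_contains_ball)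
    obtain n where n: "inverse (real (Suc n)) < e / 2" using reals_Archimedean[of "e / 2"] e(1) by auto
    obtain d where d: "d \<in> D" "dist f d < inverse (real (Suc n))" using D(2)[of "inverse (real (Suc n))" f] by auto
    have "ball d (inverse (real (Suc n))) \<subseteq> U"
    proof
      fix g assume "g \<in> ball d (inverse (real (Suc n)))"
      then have "dist f g < e" using dist_triangle[of f g d] d(2) n by (simp del: of_nat_Suc)
      then show "g \<in> U" using e(2) by auto
    qed
    then show "\<exists>B\<in>\<B>. f \<in> B \<and> B \<subseteq> U"
      using d by (intro bexI[of _ "ball d (inverse (real (Suc n)))"]) (auto simp: \<B>_def dist_commute)
  qed (auto simp: \<B>_def)
  moreover have "countable \<B>" unfolding \<B>_def using D(1) by (intro countable_image countable_SIGMA) auto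
  ultimately show "\<exists>B :: ('a \<Rightarrow>\<^sub>C 'b) set set. countable B \<and> open = generate_topology B"
    using topological_basis_imp_subbasis by blast
qed

instance bcontfun :: (compact_metric_space, polish_space) polish_space ..


section \<open>The space of continuous functions on the unit interval\<close>

typedef unit_interval = "{0..1 :: real}"
  by (rule exI[of _ 0]) simp

instantiation unit_interval :: metric_space
begin

definition dist_unit_interval :: "unit_interval \<Rightarrow> unit_interval \<Rightarrow> real"
  where "dist_unit_interval x y = dist (Rep_unit_interval x) (Rep_unit_interval y)"

definition uniformity_unit_interval :: "(unit_interval \<times> unit_interval) filter"
  where "uniformity_unit_interval = (INF e\<in>{0 <..}. principal {(x, y). dist x y < e})"

definition open_unit_interval :: "unit_interval set \<Rightarrow> bool"
  where "open_unit_interval U \<longleftrightarrow> (\<forall>x\<in>U. \<forall>\<^sub>F (x', y) in uniformity. x' = x \<longrightarrow> y \<in> U)"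

instance
proof
  fix x y z :: unit_interval
  show "dist x y = 0 \<longleftrightarrow> x = y"
    by (simp add: dist_unit_interval_def Rep_unit_interval_inject)
  show "dist x y \<le> dist x z + dist y z"
    unfolding dist_unit_interval_def by (rule dist_triangle2)
qed (rule uniformity_unit_interval_def open_unit_interval_def)+

end

lemma continuous_on_Abs_unit_interval: "continuous_on {0..1} Abs_unit_interval"
  unfolding continuous_on_iff dist_unit_interval_def
  by (auto simp: Abs_unit_interval_inverse)

instance unit_interval :: compact_metric_space
proof
  have "range Rep_unit_interval = {0..1}"
    by (rule type_definition.Rep_range[OF type_definition_unit_interval])
  then have "Abs_unit_interval ` {0..1} = (\<lambda>x. Abs_unit_interval (Rep_unit_interval x)) ` UNIV"
    by (metis image_image)
  then have "Abs_unit_interval ` {0..1} = UNIV"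
    by (simp add: Rep_unit_interval_inverse)
  then show "compact (UNIV :: unit_interval set)"
    using compact_continuous_image[OF continuous_on_Abs_unit_interval] by simp
qed

text \<open>
  Since \<^typ>\<open>unit_interval\<close> is compact, \<open>bcontfun\<close> does not lose any continuous function;
  its metric is the supremum metric.
\<close>

type_synonym C01 = "unit_interval \<Rightarrow>\<^sub>C real"

lemma continuous_unit_interval_bcontfun:
  fixes f :: "unit_interval \<Rightarrow> real"
  shows "f \<in> bcontfun \<longleftrightarrow> continuous_on UNIV f"
proof
  assume "continuous_on UNIV f"
  moreover from this have "bounded (range f)"
    by (intro compact_imp_bounded compact_continuous_image compact_UNIV_metric)
  ultimately show "f \<in> bcontfun" by (simp add: bcontfun_def)
qed (simp add: bcontfun_def)

text \<open>
  The function below is evaluated only at points of \<open>{0..1}\<close>, because of the filter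
  \<open>at x within {0..1}\<close>; at \<open>0\<close> and \<open>1\<close> this filter yields the one-sided derivatives.
\<close>

definition SD :: "C01 set"
  where "SD = {f. \<exists>x\<in>{0..1}. \<exists>D.
    ((\<lambda>t. apply_bcontfun f (Abs_unit_interval t)) has_real_derivative D) (at x within {0..1})}"

end

theory Submission
  imports Defs
begin

text \<open>
  Every Cantor set \<open>C\<close> of continuous functions has a translate with uncountably many members
  in \<^const>\<open>SD\<close>. A Borel set \<open>B\<close> containing \<^const>\<open>SD\<close> then meets that translate in an
  uncountable set too, whatever \<open>B\<close> is, so no pair \<open>B\<close>, \<open>C\<close> witnesses Haar-countability.

  The translate comes from uncountably many members \<open>g \<alpha>\<close> of \<open>C\<close>, each with its own point
  \<open>x \<alpha>\<close> of the interval, and one continuous function \<open>h\<close> that is tangent to every \<open>g \<alpha>\<close> at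
  \<open>x \<alpha>\<close>: if \<open>g \<alpha> - h\<close> is \<open>O((t - x \<alpha>)\<^sup>2)\<close>, its derivative at \<open>x \<alpha>\<close> exists and is \<open>0\<close>.
  Such an \<open>h\<close> can exist only if \<open>g \<alpha>\<close> and \<open>g \<beta>\<close> nearly agree near \<open>x \<alpha>\<close> when \<open>x \<alpha>\<close> and \<open>x \<beta>\<close> are close;
  conversely, a uniform distance of at most \<open>\<bar>x \<alpha> - x \<beta>\<bar>\<^sup>2 / 2\<close> is enough, and then the infimum
  of the functions \<open>g \<alpha> t + (t - x \<alpha>)\<^sup>2\<close> is a suitable \<open>h\<close> (\<open>quadratic_envelope\<close>).

  The rate is achieved by letting the \<open>x \<alpha>\<close> run through the ternary Cantor set, where points
  with first different digit \<open>n\<close> are at least \<open>3\<^sup>-\<^sup>n\<^sup>-\<^sup>1\<close> apart (\<open>ternary_point_separation\<close>), and by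
  passing to a subset of \<open>C\<close> whose branches at level \<open>n\<close> are as small as desired
  (\<open>Cantor_space_thinning\<close>).
\<close>

section \<open>Points of the Cantor ternary set\<close>

definition ternary_point :: "(nat \<Rightarrow> bool) \<Rightarrow> real"
  where "ternary_point \<alpha> = (\<Sum>n. of_bool (\<alpha> n) * (2 / 3 ^ Suc n))"

lemma sums_ternary_digits: "(\<lambda>n. 2 / 3 ^ Suc n :: real) sums 1"
proof -
  have "(\<lambda>n. (2/3) * (1 / 3 :: real) ^ n) sums ((2/3) * (1 / (1 - 1 / 3)))"
    by (intro sums_mult geometric_sums) simp
  then show ?thesis by (simp add: power_divide)
qed

lemma summable_ternary_point: "summable (\<lambda>n. of_bool (\<alpha> n) * (2 / 3 ^ Suc n :: real))"
  by (rule summable_comparison_test'[OF sums_summable[OF sums_ternary_digits]]) auto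

lemma ternary_point_in_unit_interval: "ternary_point \<alpha> \<in> {0..1}"
proof -
  have "ternary_point \<alpha> \<le> (\<Sum>n. 2 / 3 ^ Suc n)"
    unfolding ternary_point_def
    by (intro suminf_le summable_ternary_point sums_summable[OF sums_ternary_digits]) auto
  moreover have "0 \<le> ternary_point \<alpha>"
    unfolding ternary_point_def by (intro suminf_nonneg summable_ternary_point) auto
  ultimately show ?thesis using sums_unique[OF sums_ternary_digits] by simp
qed

lemma ternary_point_split_head:
  "ternary_point \<alpha> = (2 * of_bool (\<alpha> 0) + ternary_point (\<lambda>n. \<alpha> (Suc n))) / 3"
proof -
  have "ternary_point \<alpha> = 2 * of_bool (\<alpha> 0) / 3 + (\<Sum>n. of_bool (\<alpha> (Suc n)) * (2 / 3 ^ Suc (Suc n)))"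
    unfolding ternary_point_def using suminf_split_head[OF summable_ternary_point[of \<alpha>]] by simp
  also have "(\<Sum>n. of_bool (\<alpha> (Suc n)) * (2 / 3 ^ Suc (Suc n)))
      = (\<Sum>n. of_bool (\<alpha> (Suc n)) * (2 / 3 ^ Suc n) / 3 :: real)"
    by simp
  also have "\<dots> = ternary_point (\<lambda>n. \<alpha> (Suc n)) / 3"
    unfolding ternary_point_def by (rule suminf_divide[OF summable_ternary_point])
  finally show ?thesis by (simp add: add_divide_distrib)
qed

text \<open>
  Removing a common first digit scales the distance by \<open>3\<close>, so it is enough to treat \<open>n = 0\<close>:
  there the two points lie in \<open>[0, 1/3]\<close> and \<open>[2/3, 1]\<close>.
\<close>

lemma ternary_point_separation:
  assumes "\<And>i. i < n \<Longrightarrow> \<alpha> i = \<beta> i" and "\<alpha> n \<noteq> \<beta> n"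
  shows "1 / 3 ^ Suc n \<le> \<bar>ternary_point \<alpha> - ternary_point \<beta>\<bar>"
  using assms
proof (induction n arbitrary: \<alpha> \<beta>)
  case 0
  have "ternary_point (\<lambda>n. \<alpha> (Suc n)) \<in> {0..1}" "ternary_point (\<lambda>n. \<beta> (Suc n)) \<in> {0..1}"
    by (rule ternary_point_in_unit_interval)+
  then show ?case
    using 0 ternary_point_split_head[of \<alpha>] ternary_point_split_head[of \<beta>]
    by (cases "\<alpha> 0"; cases "\<beta> 0") (auto simp: abs_if)
next
  case (Suc n)
  have "1 / 3 ^ Suc n \<le> \<bar>ternary_point (\<lambda>n. \<alpha> (Suc n)) - ternary_point (\<lambda>n. \<beta> (Suc n))\<bar>"
    using Suc.prems by (intro Suc.IH) auto
  moreover have "ternary_point \<alpha> - ternary_point \<beta>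
      = (ternary_point (\<lambda>n. \<alpha> (Suc n)) - ternary_point (\<lambda>n. \<beta> (Suc n))) / 3"
    using Suc.prems(1)[of 0] ternary_point_split_head[of \<alpha>] ternary_point_split_head[of \<beta>]
    by (simp add: diff_divide_distrib add_divide_distrib)
  ultimately show ?case by (simp add: abs_divide)
qed


section \<open>Thinning out a Cantor set\<close>

lemma uncountable_Cantor_space: "uncountable (UNIV :: (nat \<Rightarrow> bool) set)"
proof
  assume "countable (UNIV :: (nat \<Rightarrow> bool) set)"
  then obtain e :: "nat \<Rightarrow> nat \<Rightarrow> bool" where "range e = UNIV"
    using uncountable_def[of "UNIV :: (nat \<Rightarrow> bool) set"] by blast
  \<comment> \<open>Cantor's diagonal sequence\<close>
  then obtain n where "e n = (\<lambda>k. \<not> e k k)" by (metis UNIV_I imageE)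
  then show False by (metis (full_types))
qed

lemma compact_Cantor_space: "compact (UNIV :: (nat \<Rightarrow> bool) set)"
proof -
  have "compactin (product_topology (\<lambda>_::nat. euclidean :: bool topology) UNIV) (PiE UNIV (\<lambda>_. UNIV))"
    unfolding compactin_PiE by (simp add: finite_imp_compact)
  then show ?thesis by (simp add: euclidean_product_topology PiE_UNIV_domain)
qed

text \<open>
  This is uniform continuity of \<open>\<phi>\<close>, with the number of common digits in place of a metric on
  the Cantor space. Continuity at \<open>u\<close> makes \<open>\<phi>\<close> vary by less than \<open>e / 2\<close> on a cylinder around
  \<open>u\<close>, and by compactness finitely many of these cylinders suffice.
\<close>

lemma Cantor_space_modulus_of_continuity:
  fixes \<phi> :: "(nat \<Rightarrow> bool) \<Rightarrow> 'a::metric_space"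
  assumes cont: "continuous_on UNIV \<phi>" and "e > 0"
  obtains m where "\<And>u v. (\<And>i. i < m \<Longrightarrow> u i = v i) \<Longrightarrow> dist (\<phi> u) (\<phi> v) < e"
proof -
  have coordinatewise: "w \<longlonglongrightarrow> l \<longleftrightarrow> (\<forall>i. (\<lambda>k. w k i) \<longlonglongrightarrow> l i)"
    for w :: "nat \<Rightarrow> nat \<Rightarrow> bool" and l
    using limitin_componentwise[of "\<lambda>_::nat. euclidean :: bool topology" UNIV w l sequentially]
    by (simp add: euclidean_product_topology)
  have "\<exists>n. \<forall>v. (\<forall>i<n. v i = u i) \<longrightarrow> dist (\<phi> v) (\<phi> u) < e / 2" for u
  proof (rule ccontr)
    assume "\<not> ?thesis"
    then obtain v where v: "\<And>n i. i < n \<Longrightarrow> v n i = u i" "\<And>n. dist (\<phi> (v n)) (\<phi> u) \<ge> e / 2"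
      by (metis not_less)
    have "(\<lambda>n. v n i) \<longlonglongrightarrow> u i" for i
    proof (rule tendsto_eventually)
      show "\<forall>\<^sub>F n in sequentially. v n i = u i"
        using eventually_gt_at_top[of i] by eventually_elim (rule v(1))
    qed
    then have "(\<lambda>n. \<phi> (v n)) \<longlonglongrightarrow> \<phi> u"
      using coordinatewise by (intro continuous_on_tendsto_compose[OF cont]) auto
    then have "\<forall>\<^sub>F n in sequentially. dist (\<phi> (v n)) (\<phi> u) < e / 2"
      using \<open>e > 0\<close> by (intro tendstoD) auto
    then show False using v(2) by (auto simp: eventually_sequentially not_less[symmetric])
  qed
  then obtain N where N: "\<And>u v. (\<And>i. i < N u \<Longrightarrow> v i = u i) \<Longrightarrow> dist (\<phi> v) (\<phi> u) < e / 2"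
    by metis
  define cyl where "cyl u = (\<Inter>i<N u. (\<lambda>v. v i) -` {u i})" for u :: "nat \<Rightarrow> bool"
  have "open (cyl u)" for u
    unfolding cyl_def by (intro open_INT finite_lessThan ballI open_vimage open_discrete
        continuous_on_product_coordinates)
  moreover have "u \<in> cyl u" for u by (simp add: cyl_def)
  ultimately obtain U where U: "finite U" "UNIV \<subseteq> (\<Union>u\<in>U. cyl u)"
    by (rule_tac compactE_image[OF compact_Cantor_space, of UNIV cyl]) auto
  show ?thesis
  proof
    fix v w :: "nat \<Rightarrow> bool"
    assume vw: "\<And>i. i < Max (N ` U) \<Longrightarrow> v i = w i"
    obtain u where u: "u \<in> U" "v \<in> cyl u" using U(2) by blast
    have Nu: "N u \<le> Max (N ` U)" using U(1) u(1) by simp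
    have v: "v i = u i" if "i < N u" for i using u(2) that by (simp add: cyl_def)
    have w: "w i = u i" if "i < N u" for i using v[OF that] vw[of i] Nu that by simp
    have "dist (\<phi> v) (\<phi> u) < e / 2" using v by (rule N)
    moreover have "dist (\<phi> w) (\<phi> u) < e / 2" using w by (rule N)
    ultimately show "dist (\<phi> v) (\<phi> w) < e" by (rule dist_triangle_half_l)
  qed
qed

text \<open>
  If \<open>\<psi>\<close> moves the digits to sparse positions \<open>k 0 < k 1 < \<dots>\<close> and fills the gaps with a fixed
  digit, then sequences that agree before \<open>n\<close> are mapped to sequences that agree before \<open>k n\<close>.
  So \<open>k n\<close> only has to exceed the modulus of continuity of \<open>\<phi>\<close> for \<open>\<epsilon> n\<close>.
\<close>

lemma Cantor_space_thinning:
  fixes \<phi> :: "(nat \<Rightarrow> bool) \<Rightarrow> 'a::metric_space"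
  assumes cont: "continuous_on UNIV \<phi>" and pos: "\<And>n. \<epsilon> n > 0"
  obtains \<psi> :: "(nat \<Rightarrow> bool) \<Rightarrow> nat \<Rightarrow> bool"
  where "inj \<psi>"
    and "\<And>\<alpha> \<beta> n. (\<And>i. i < n \<Longrightarrow> \<alpha> i = \<beta> i) \<Longrightarrow> dist (\<phi> (\<psi> \<alpha>)) (\<phi> (\<psi> \<beta>)) < \<epsilon> n"
proof -
  have "\<exists>m. \<forall>u v. (\<forall>i<m. u i = v i) \<longrightarrow> dist (\<phi> u) (\<phi> v) < \<epsilon> n" for n
    using Cantor_space_modulus_of_continuity[OF cont pos[of n]] by metis
  then obtain m where m: "\<And>n u v. (\<And>i. i < m n \<Longrightarrow> u i = v i) \<Longrightarrow> dist (\<phi> u) (\<phi> v) < \<epsilon> n"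
    by metis
  define k where "k n = (\<Sum>i\<le>n. Suc (m i))" for n
  have k: "strict_mono k" by (rule strict_monoI_Suc) (simp add: k_def)
  have mk: "m n \<le> k n" for n
    using member_le_sum[of n "{..n}" "\<lambda>i. Suc (m i)"] by (simp add: k_def)
  define \<psi> where "\<psi> \<alpha> j = (\<exists>i. k i = j \<and> \<alpha> i)" for \<alpha> j
  have \<psi>_k: "\<psi> \<alpha> (k i) = \<alpha> i" for \<alpha> i
    using strict_mono_eq[OF k] by (auto simp: \<psi>_def)
  show ?thesis
  proof
    show "inj \<psi>" by (rule injI, rule ext) (metis \<psi>_k)
    show "dist (\<phi> (\<psi> \<alpha>)) (\<phi> (\<psi> \<beta>)) < \<epsilon> n" if "\<And>i. i < n \<Longrightarrow> \<alpha> i = \<beta> i" for \<alpha> \<beta> n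
    proof (rule m)
      fix j assume "j < m n"
      then have "i < n" if "k i = j" for i
        using mk[of n] strict_mono_less[OF k, of i n] that by simp
      then show "\<psi> \<alpha> j = \<psi> \<beta> j" using that by (auto simp: \<psi>_def)
    qed
  qed
qed


section \<open>A common tangent to a quadratically clustered family\<close>

lemma continuous_on_eval_bcontfun:
  "continuous_on UNIV (\<lambda>(f :: 'a::topological_space \<Rightarrow>\<^sub>C 'b::metric_space, t). apply_bcontfun f t)"
proof -
  have "((\<lambda>z. apply_bcontfun (fst z) (snd z)) \<longlongrightarrow> apply_bcontfun f t) (at (f, t))"
    for f :: "'a \<Rightarrow>\<^sub>C 'b" and t
  proof (rule tendstoI)
    fix e :: real assume e: "e > 0"
    have "\<forall>\<^sub>F z in at (f, t). dist (fst z) f < e / 2"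
      using tendstoD[OF tendsto_fst[OF tendsto_ident_at, of "(f, t)" UNIV], of "e / 2"] e by simp
    moreover have "((\<lambda>z. apply_bcontfun f (snd z)) \<longlongrightarrow> apply_bcontfun f t) (at (f, t))"
      using continuous_on_tendsto_compose[OF continuous_on_apply_bcontfun[of UNIV f]
          tendsto_snd[OF tendsto_ident_at, of "(f, t)" UNIV]] by simp
    then have "\<forall>\<^sub>F z in at (f, t). dist (apply_bcontfun f (snd z)) (apply_bcontfun f t) < e / 2"
      using e by (intro tendstoD) auto
    ultimately show "\<forall>\<^sub>F z in at (f, t). dist (apply_bcontfun (fst z) (snd z)) (apply_bcontfun f t) < e"
    proof eventually_elim
      case (elim z)
      have "dist (apply_bcontfun (fst z) (snd z)) (apply_bcontfun f (snd z)) < e / 2"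
        using dist_bounded[of "fst z" "snd z" f] elim(1) by simp
      then show ?case
        using dist_triangle[of "apply_bcontfun (fst z) (snd z)" "apply_bcontfun f t" "apply_bcontfun f (snd z)"]
          elim(2) by simp
    qed
  qed
  then show ?thesis by (auto simp: continuous_on_def split_def)
qed

text \<open>
  The envelope is \<open>h t = (INF i. g i t + (dist t (x i))\<^sup>2)\<close>. The upper bound
  \<open>h t \<le> g i t + (dist t (x i))\<^sup>2\<close> is immediate. For the lower bound, every competitor satisfies
  \<open>g j t \<ge> g i t - (dist (x i) (x j))\<^sup>2 / 2\<close>, and
  \<open>(dist (x i) (x j))\<^sup>2 / 2 \<le> (dist t (x i))\<^sup>2 + (dist t (x j))\<^sup>2\<close>; the last summand is exactly the
  penalty that \<open>j\<close> pays. This is why the clustering rate carries the factor \<open>1 / 2\<close>.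

  Compactness of \<open>C\<close> makes the functions under the infimum uniformly equicontinuous, so that
  \<open>h\<close> is continuous.
\<close>

lemma quadratic_envelope:
  fixes g :: "'i \<Rightarrow> ('a::compact_metric_space \<Rightarrow>\<^sub>C real)" and x :: "'i \<Rightarrow> 'a"
  assumes C: "compact C" "range g \<subseteq> C"
    and close: "\<And>i j. dist (g i) (g j) \<le> (dist (x i) (x j))\<^sup>2 / 2"
  obtains h :: "'a \<Rightarrow>\<^sub>C real"
  where "\<And>i t. \<bar>apply_bcontfun (g i) t - apply_bcontfun h t\<bar> \<le> (dist t (x i))\<^sup>2"
proof -
  define F where "F = (\<lambda>(f :: 'a \<Rightarrow>\<^sub>C real, p, t). apply_bcontfun f t + (dist t p)\<^sup>2)"
  have "continuous_on (C \<times> UNIV \<times> UNIV) (\<lambda>z. apply_bcontfun (fst z) (snd (snd z)))"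
    using continuous_on_compose2[OF continuous_on_eval_bcontfun,
        of "C \<times> UNIV \<times> UNIV" "\<lambda>z. (fst z, snd (snd z))"]
    by (simp add: continuous_on_Pair continuous_on_fst continuous_on_snd continuous_on_id)
  then have F: "continuous_on (C \<times> UNIV \<times> UNIV) F"
    unfolding F_def split_def by (intro continuous_intros)
  have K: "compact (C \<times> (UNIV :: 'a set) \<times> (UNIV :: 'a set))"
    by (intro compact_Times C(1) compact_UNIV_metric)
  define G where "G i t = F (g i, x i, t)" for i t
  define h where "h t = (INF i. G i t)" for t
  have "bounded (F ` (C \<times> UNIV \<times> UNIV))"
    by (intro compact_imp_bounded compact_continuous_image F K)
  then obtain b where b: "\<And>z. z \<in> C \<times> UNIV \<times> UNIV \<Longrightarrow> \<bar>F z\<bar> \<le> b"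
    by (auto simp: bounded_iff)
  have "- b \<le> G i t" for i t using b[of "(g i, x i, t)"] C(2) by (force simp: G_def abs_le_iff)
  then have bdd: "bdd_below (range (\<lambda>i. G i t))" for t by (intro bdd_belowI) auto
  have h_le: "h t \<le> G i t" for i t unfolding h_def by (rule cINF_lower[OF bdd]) simp
  have le_h: "a \<le> h t" if "\<And>i. a \<le> G i t" for a t
    unfolding h_def by (rule cINF_greatest) (use that in auto)
  \<comment> \<open>one modulus of continuity of \<open>F\<close> serves all \<open>G i\<close>, hence also their infimum\<close>
  have "uniformly_continuous_on UNIV h"
    unfolding uniformly_continuous_on_def
  proof (intro allI impI)
    fix e :: real assume "e > 0"
    then obtain d where d: "d > 0" "\<And>y z. y \<in> C \<times> UNIV \<times> UNIV \<Longrightarrow> z \<in> C \<times> UNIV \<times> UNIV \<Longrightarrow>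
        dist z y < d \<Longrightarrow> dist (F z) (F y) < e / 2"
      using compact_uniformly_continuous[OF F K] unfolding uniformly_continuous_on_def
      by (metis half_gt_zero)
    have G: "\<bar>G i s - G i t\<bar> < e / 2" if "dist s t < d" for i s t
      using d(2)[of "(g i, x i, t)" "(g i, x i, s)"] C(2) that
      by (auto simp: G_def dist_Pair_Pair dist_real_def)
    have half: "h s - e / 2 \<le> h t" if "dist s t < d" for s t
    proof (rule le_h)
      fix i show "h s - e / 2 \<le> G i t" using h_le[of s i] G[OF that, of i] by linarith
    qed
    have "dist (h s) (h t) < e" if "dist s t < d" for s t
      using half[OF that] half[of t s] that \<open>e > 0\<close> by (simp add: dist_real_def dist_commute)
    then show "\<exists>d>0. \<forall>t\<in>UNIV. \<forall>s\<in>UNIV. dist s t < d \<longrightarrow> dist (h s) (h t) < e"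
      using d(1) by blast
  qed
  then have cont: "continuous_on UNIV h" by (rule uniformly_continuous_imp_continuous)
  have "bounded (range h)"
    by (intro compact_imp_bounded compact_continuous_image compact_UNIV_metric cont)
  then have h: "apply_bcontfun (Bcontfun h) = h"
    by (intro Bcontfun_inverse) (simp add: bcontfun_def cont)
  show ?thesis
  proof
    fix i t
    have "apply_bcontfun (g i) t - (dist t (x i))\<^sup>2 \<le> h t"
    proof (rule le_h)
      fix j
      have "(dist (x i) (x j))\<^sup>2 \<le> (dist t (x i) + dist t (x j))\<^sup>2"
        by (intro power_mono) (auto simp: dist_triangle3)
      also have "\<dots> \<le> 2 * (dist t (x i))\<^sup>2 + 2 * (dist t (x j))\<^sup>2"
        using sum_squares_bound[of "dist t (x i)" "dist t (x j)"] by (simp add: power2_sum)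
      finally have "dist (apply_bcontfun (g i) t) (apply_bcontfun (g j) t)
          \<le> (dist t (x i))\<^sup>2 + (dist t (x j))\<^sup>2"
        using dist_bounded[of "g i" t "g j"] close[of i j] by linarith
      then show "apply_bcontfun (g i) t - (dist t (x i))\<^sup>2 \<le> G j t"
        by (simp add: G_def F_def dist_real_def)
    qed
    moreover have "h t \<le> apply_bcontfun (g i) t + (dist t (x i))\<^sup>2"
      using h_le[of t i] by (simp add: G_def F_def)
    ultimately show "\<bar>apply_bcontfun (g i) t - apply_bcontfun (Bcontfun h) t\<bar> \<le> (dist t (x i))\<^sup>2"
      unfolding h by linarith
  qed
qed

lemma quadratically_flat_imp_zero_derivative:
  fixes f :: "real \<Rightarrow> real"
  assumes "a \<in> S" and flat: "\<And>t. t \<in> S \<Longrightarrow> \<bar>f t\<bar> \<le> (t - a)\<^sup>2"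
  shows "(f has_real_derivative 0) (at a within S)"
proof -
  have a: "f a = 0" using flat[OF \<open>a \<in> S\<close>] by simp
  have "((\<lambda>t. (f t - f a) / (t - a)) \<longlongrightarrow> 0) (at a within S)"
  proof (rule Lim_null_comparison)
    show "\<forall>\<^sub>F t in at a within S. norm ((f t - f a) / (t - a)) \<le> \<bar>t - a\<bar>"
      unfolding eventually_at_filter
    proof (intro always_eventually allI impI)
      fix t assume "t \<noteq> a" "t \<in> S"
      then show "norm ((f t - f a) / (t - a)) \<le> \<bar>t - a\<bar>"
        using flat[of t] a by (simp add: divide_le_eq power2_eq_square flip: abs_mult)
    qed
    show "((\<lambda>t. \<bar>t - a\<bar>) \<longlongrightarrow> 0) (at a within S)"
      by (rule tendsto_eq_intros | simp)+
  qed
  then show ?thesis by (simp add: has_field_derivative_iff)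
qed


section \<open>Somewhere differentiable functions in translates of Cantor sets\<close>

text \<open>
  The members \<open>g \<alpha>\<close> come from a thinning of \<open>C\<close> at the rate \<open>(3\<^sup>-\<^sup>n\<^sup>-\<^sup>1)\<^sup>2 / 2\<close>, which is half the
  squared separation of the ternary points. The translation is by \<open>- h\<close> for their envelope \<open>h\<close>.
\<close>

lemma Cantor_set_translate_meets_SD:
  fixes C :: "C01 set"
  assumes "C homeomorphic (UNIV :: (nat \<Rightarrow> bool) set)"
  obtains f where "uncountable ((\<lambda>c. c + f) ` C \<inter> SD)"
proof -
  obtain \<phi> \<phi>' where hom: "homeomorphism (UNIV :: (nat \<Rightarrow> bool) set) C \<phi> \<phi>'"
    using assms homeomorphic_sym unfolding homeomorphic_def by blast
  then have \<phi>: "continuous_on UNIV \<phi>" "range \<phi> = C" "inj \<phi>"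
    by (auto simp: homeomorphism_def intro: inj_on_inverseI)
  have C: "compact C"
    using compact_continuous_image[OF \<phi>(1) compact_Cantor_space] \<phi>(2) by simp
  obtain \<psi> :: "(nat \<Rightarrow> bool) \<Rightarrow> nat \<Rightarrow> bool" where \<psi>: "inj \<psi>"
    "\<And>\<alpha> \<beta> n. (\<And>i. i < n \<Longrightarrow> \<alpha> i = \<beta> i) \<Longrightarrow> dist (\<phi> (\<psi> \<alpha>)) (\<phi> (\<psi> \<beta>)) < (1 / 3 ^ Suc n)\<^sup>2 / 2"
    using Cantor_space_thinning[OF \<phi>(1), of "\<lambda>n. (1 / 3 ^ Suc n)\<^sup>2 / 2"] by auto
  define g where "g \<alpha> = \<phi> (\<psi> \<alpha>)" for \<alpha>
  define x where "x \<alpha> = Abs_unit_interval (ternary_point \<alpha>)" for \<alpha>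
  have Rep_x: "Rep_unit_interval (x \<alpha>) = ternary_point \<alpha>" for \<alpha>
    unfolding x_def by (rule Abs_unit_interval_inverse[OF ternary_point_in_unit_interval])
  have g: "inj g" "range g \<subseteq> C"
    using \<phi>(2) inj_compose[OF \<phi>(3) \<psi>(1)] by (auto simp: g_def[abs_def] comp_def)
  have "dist (g \<alpha>) (g \<beta>) \<le> (dist (x \<alpha>) (x \<beta>))\<^sup>2 / 2" for \<alpha> \<beta>
  proof (cases "\<alpha> = \<beta>")
    case False
    then obtain n where n: "\<alpha> n \<noteq> \<beta> n" "\<And>i. i < n \<Longrightarrow> \<alpha> i = \<beta> i"
      using exists_least_iff[of "\<lambda>n. \<alpha> n \<noteq> \<beta> n"] by auto
    have "(1 / 3 ^ Suc n)\<^sup>2 \<le> (dist (x \<alpha>) (x \<beta>))\<^sup>2"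
      using ternary_point_separation[of n \<alpha> \<beta>] n
      by (intro power_mono) (auto simp: dist_unit_interval_def dist_real_def Rep_x)
    moreover have "dist (g \<alpha>) (g \<beta>) < (1 / 3 ^ Suc n)\<^sup>2 / 2"
      unfolding g_def using n(2) by (rule \<psi>(2))
    ultimately show ?thesis by linarith
  qed simp
  then obtain h where h: "\<And>\<alpha> t. \<bar>apply_bcontfun (g \<alpha>) t - apply_bcontfun h t\<bar> \<le> (dist t (x \<alpha>))\<^sup>2"
    using quadratic_envelope[OF C g(2), of x] by blast
  have "g \<alpha> + (- h) \<in> SD" for \<alpha>
  proof -
    have "((\<lambda>t. apply_bcontfun (g \<alpha> + (- h)) (Abs_unit_interval t)) has_real_derivative 0)
        (at (ternary_point \<alpha>) within {0..1})"
    proof (rule quadratically_flat_imp_zero_derivative[OF ternary_point_in_unit_interval])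
      fix t :: real assume "t \<in> {0..1}"
      then show "\<bar>apply_bcontfun (g \<alpha> + (- h)) (Abs_unit_interval t)\<bar> \<le> (t - ternary_point \<alpha>)\<^sup>2"
        using h[of \<alpha> "Abs_unit_interval t"]
        by (simp add: dist_unit_interval_def dist_real_def Rep_x Abs_unit_interval_inverse)
    qed
    then show ?thesis unfolding SD_def using ternary_point_in_unit_interval by blast
  qed
  then have "range (\<lambda>\<alpha>. g \<alpha> + (- h)) \<subseteq> (\<lambda>c. c + (- h)) ` C \<inter> SD"
    using g(2) by blast
  moreover have "inj (\<lambda>\<alpha>. g \<alpha> + (- h))" using g(1) by (simp add: inj_def)
  then have "uncountable (range (\<lambda>\<alpha>. g \<alpha> + (- h)))"
    using uncountable_Cantor_space countable_image_inj_on by blast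
  ultimately have "uncountable ((\<lambda>c. c + (- h)) ` C \<inter> SD)"
    using countable_subset by blast
  then show ?thesis by (rule that)
qed

theorem theorem2p2:
  shows "\<not> haar_countable SD"
proof
  assume "haar_countable SD"
  then obtain B C where BC: "SD \<subseteq> B" "C homeomorphic (UNIV :: (nat \<Rightarrow> bool) set)"
    "\<And>x. countable ((\<lambda>c. c + x) ` C \<inter> B)"
    unfolding haar_countable_def by blast
  obtain f where "uncountable ((\<lambda>c. c + f) ` C \<inter> SD)"
    using Cantor_set_translate_meets_SD[OF BC(2)] .
  moreover have "(\<lambda>c. c + f) ` C \<inter> SD \<subseteq> (\<lambda>c. c + f) ` C \<inter> B" using BC(1) by blast
  ultimately show False using BC(3) countable_subset by blast
qed

end
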